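(* Let $s,t\in\frac12\mathbb{Z}$ with $s+t+1\in\mathbb{N}$, and let $\alpha\in\mathbb{C}\setminus\mathbb{Z}$. Then the function $$f_{s,t}(x):=F\left(\tfrac{\alpha}{2}-s,\tfrac{\alpha+1}{2}-t,\alpha+1;x\right)F\left(-\tfrac{\alpha}{2}-s,\tfrac{-\alpha+1}{2}-t,-\alpha+1;x\right)$$ is a polynomial in $x$, of degree $2s$ when $s-t+1\in\mathbb{N}$, and of degree $2t-1$ when $t-s\in\mathbb{N}$.
   Context: $\mathbb{N}=\{1,2,3,\dots\}$. $F(a,b,c;x)=\sum_{n\ge0}\frac{(a,n)(b,n)}{(c,n)(1,n)}x^n$, where $(a,n)=a(a+1)\cdots(a+n-1)$ (with $(a,0)=1$). *)

theory Defs
  imports "HOL-Analysis.Analysis"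
begin

text \<open>The Gauss hypergeometric series. It is only meaningful where the series converges, in
  particular for \<open>norm x < 1\<close> when \<open>c\<close> is not a non-positive integer; \<open>suminf\<close> is unspecified
  for divergent series.\<close>

definition hypergeo_F :: "complex \<Rightarrow> complex \<Rightarrow> complex \<Rightarrow> complex \<Rightarrow> complex" where
  "hypergeo_F a b c x =
     (\<Sum>n. pochhammer a n * pochhammer b n / (pochhammer c n * pochhammer 1 n) * x ^ n)"

lemma hypergeo_F_eq_eval_fps: "hypergeo_F a b c x = eval_fps (fps_hypergeo [a, b] [c] 1) x"
  by (simp add: hypergeo_F_def eval_fps_def flip: pochhammer_fact)

definition hypergeo_prod :: "real \<Rightarrow> real \<Rightarrow> complex \<Rightarrow> complex \<Rightarrow> complex" where
  "hypergeo_prod s t \<alpha> x =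
     hypergeo_F (\<alpha> / 2 - of_real s) ((\<alpha> + 1) / 2 - of_real t) (\<alpha> + 1) x *
     hypergeo_F (- \<alpha> / 2 - of_real s) ((- \<alpha> + 1) / 2 - of_real t) (- \<alpha> + 1) x"

end

theory Submission
  imports Defs
begin

text \<open>
  Put \<open>a = \<alpha> / 2 - s\<close> and \<open>b = (\<alpha> + 1) / 2 - t\<close>. Up to the factor \<open>x powr - \<alpha>\<close> on the second one, the
  two series are the local solutions at the origin of one hypergeometric equation, so every
  contiguity operator \<open>p + q (1 - x) x d / dx\<close> with polynomials \<open>p\<close>, \<open>q\<close> acts on both at once. Hence,
  writing \<open>u\<close>, \<open>v\<close> for the solutions and \<open>u'\<close>, \<open>v'\<close> for their images under \<open>x d / dx\<close>, polynomiality of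
  both \<open>u v\<close> and \<open>(1 - x) u' v'\<close> propagates from \<open>s = t = 0\<close>, where \<open>u v = 1\<close>, along
  \<open>(s, t) \<mapsto> (s + 1, t - 1)\<close>, \<open>(s - 1, t + 1)\<close> and \<open>(s + 1, t)\<close>. The degree \<open>e\<close> of \<open>u v\<close> is an exponent
  at infinity of the symmetric square of the equation, which leaves \<open>e = 2 s\<close>, \<open>e = 2 t - 1\<close> or
  \<open>e = s + t - 1 / 2\<close>, and the closed form of the Wronskian forces \<open>e \<ge> s + t\<close>.
\<close>

section \<open>The Euler operator of weight \<open>\<beta>\<close> on formal power series\<close>

definition euler_op :: "complex \<Rightarrow> complex fps \<Rightarrow> complex fps" where
  "euler_op \<beta> F = fps_X * fps_deriv F - fps_const \<beta> * F"

lemma euler_op_nth: "fps_nth (euler_op \<beta> F) n = (of_nat n - \<beta>) * fps_nth F n"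
  by (cases n) (simp_all add: euler_op_def algebra_simps)

text \<open>Leibniz rule: weight \<open>\<beta>\<close> stands for a factor
  \<open>x powr - \<beta>\<close>, and such exponents add under multiplication.\<close>

lemma euler_op_mult: "euler_op (\<beta> + \<gamma>) (F * G) = euler_op \<beta> F * G + F * euler_op \<gamma> G"
  by (simp add: euler_op_def algebra_simps flip: fps_const_add)

lemma euler_op_add: "euler_op \<beta> (F + G) = euler_op \<beta> F + euler_op \<beta> G"
  by (simp add: euler_op_def algebra_simps)

lemma euler_op_mult_left: "euler_op \<beta> (F * G) = euler_op 0 F * G + F * euler_op \<beta> G"
  using euler_op_mult[of 0 \<beta> F G] by simp

lemma euler_op_shift: "euler_op (\<beta> + \<gamma>) F = euler_op \<beta> F - fps_const \<gamma> * F"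
  by (simp add: euler_op_def algebra_simps flip: fps_const_add)

lemma euler_op_const: "euler_op \<beta> (fps_const k) = - fps_const (\<beta> * k)"
  by (simp add: euler_op_def)

section \<open>Formal power series that are polynomials\<close>

abbreviation polynomial_fps :: "complex fps \<Rightarrow> bool" where
  "polynomial_fps F \<equiv> F \<in> range fps_of_poly"

lemma polynomial_fps_const: "polynomial_fps (fps_const k)"
  by (metis fps_of_poly_const rangeI)

lemma polynomial_fps_1: "polynomial_fps 1"
  by (metis fps_of_poly_1 rangeI)

lemma polynomial_fps_X: "polynomial_fps fps_X"
  by (metis fps_of_poly_fps_X rangeI)

lemma polynomial_fps_add: "polynomial_fps F \<Longrightarrow> polynomial_fps G \<Longrightarrow> polynomial_fps (F + G)"
  by (metis (no_types, lifting) fps_of_poly_add imageE rangeI)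

lemma polynomial_fps_diff: "polynomial_fps F \<Longrightarrow> polynomial_fps G \<Longrightarrow> polynomial_fps (F - G)"
  by (metis (no_types, lifting) fps_of_poly_diff imageE rangeI)

lemma polynomial_fps_mult: "polynomial_fps F \<Longrightarrow> polynomial_fps G \<Longrightarrow> polynomial_fps (F * G)"
  by (metis (no_types, lifting) fps_of_poly_mult imageE rangeI)

lemma polynomial_fps_euler_op: "polynomial_fps F \<Longrightarrow> polynomial_fps (euler_op \<beta> F)"
  unfolding euler_op_def
  by (metis (no_types, lifting) fps_of_poly_pderiv imageE rangeI polynomial_fps_X
      polynomial_fps_const polynomial_fps_mult polynomial_fps_diff)

lemmas polynomial_fps_intros =
  polynomial_fps_const polynomial_fps_1 polynomial_fps_X polynomial_fps_add
  polynomial_fps_diff polynomial_fps_mult polynomial_fps_euler_op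

section \<open>The hypergeometric equation, its solutions at the origin and their contiguity
  relations\<close>

text \<open>With \<open>D = euler_op \<beta>\<close> this is
  \<open>D (D + \<alpha>) F = x (D + a) (D + b) F\<close>, the equation with lower parameter
  \<open>\<alpha> + 1\<close>, solved for its leading term.\<close>

definition hypergeo_eq :: "complex \<Rightarrow> complex \<Rightarrow> complex \<Rightarrow> complex \<Rightarrow> complex fps \<Rightarrow> bool" where
  "hypergeo_eq \<alpha> \<beta> a b F \<longleftrightarrow>
     (1 - fps_X) * euler_op \<beta> (euler_op \<beta> F) =
     (fps_const (a + b) * fps_X - fps_const \<alpha>) * euler_op \<beta> F + fps_const (a * b) * fps_X * F"

definition gauss_fps :: "complex \<Rightarrow> complex \<Rightarrow> complex \<Rightarrow> complex fps" where
  "gauss_fps a b c =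
     Abs_fps (\<lambda>n. pochhammer a n * pochhammer b n / (pochhammer c n * pochhammer 1 n))"

lemma gauss_fps_commute: "gauss_fps a b c = gauss_fps b a c"
  by (simp add: gauss_fps_def mult.commute)

lemma gauss_fps_nth_0: "fps_nth (gauss_fps a b c) 0 = 1"
  by (simp add: gauss_fps_def)

lemma gauss_fps_nth_Suc:
  assumes "c \<notin> \<int>"
  shows "fps_nth (gauss_fps a b c) (Suc n) * (of_nat (Suc n) * (c + of_nat n)) =
         fps_nth (gauss_fps a b c) n * ((a + of_nat n) * (b + of_nat n))"
proof -
  have "c + of_nat n \<noteq> 0"
    using assms by (metis Ints_minus Ints_of_nat add_eq_0_iff2)
  moreover have "1 + of_nat n \<noteq> (0 :: complex)"
    by (metis of_nat_Suc of_nat_eq_0_iff nat.simps(3))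
  ultimately show ?thesis
    by (simp add: gauss_fps_def pochhammer_Suc divide_simps)
qed

text \<open>Coefficientwise this is \<open>(b + n) (b)_n = b (b + 1)_n\<close>. The name refers to
  \<open>t\<close>: with \<open>b = (\<alpha> + 1) / 2 - t\<close>, passing to \<open>b + 1\<close>
  lowers \<open>t\<close> by one.\<close>

lemma gauss_fps_lower:
  "euler_op 0 (gauss_fps a b c) + fps_const b * gauss_fps a b c = fps_const b * gauss_fps a (b + 1) c"
proof (rule fps_ext)
  fix n
  have "pochhammer b n * (b + of_nat n) = b * pochhammer (b + 1) n"
    by (metis pochhammer_Suc pochhammer_rec)
  then have "(b + of_nat n) * (pochhammer a n * pochhammer b n / (pochhammer c n * pochhammer 1 n))
     = b * (pochhammer a n * pochhammer (b + 1) n / (pochhammer c n * pochhammer 1 n))"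
    by (simp add: mult_ac)
  then show "fps_nth (euler_op 0 (gauss_fps a b c) + fps_const b * gauss_fps a b c) n =
             fps_nth (fps_const b * gauss_fps a (b + 1) c) n"
    by (simp only: euler_op_nth gauss_fps_def fps_add_nth fps_mult_left_const_nth fps_nth_Abs_fps
        diff_zero add.commute[of b] distrib_right)
qed

text \<open>The coefficients of index \<open>m + 1\<close> of both series are multiples of
  coefficient \<open>m\<close> of the unshifted one, so clearing denominators leaves a polynomial
  identity. With \<open>a = \<alpha> / 2 - s\<close>, passing to \<open>a - 1\<close> raises
  \<open>s\<close> by one.\<close>

lemma gauss_fps_raise:
  assumes "c \<notin> \<int>"
  shows "(1 - fps_X) * euler_op 0 (gauss_fps a b c)
           + (fps_const (c - a) - fps_const b * fps_X) * gauss_fps a b c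
         = fps_const (c - a) * gauss_fps (a - 1) b c"
proof (rule fps_ext)
  fix n
  show "fps_nth ((1 - fps_X) * euler_op 0 (gauss_fps a b c)
           + (fps_const (c - a) - fps_const b * fps_X) * gauss_fps a b c) n
         = fps_nth (fps_const (c - a) * gauss_fps (a - 1) b c) n"
  proof (cases n)
    case 0
    then show ?thesis by (simp add: euler_op_nth gauss_fps_nth_0 algebra_simps)
  next
    case (Suc m)
    let ?f = "fps_nth (gauss_fps a b c) m" and ?f1 = "fps_nth (gauss_fps a b c) (Suc m)"
      and ?g = "fps_nth (gauss_fps (a - 1) b c) (Suc m)"
    define M where "M = (of_nat m :: complex)"
    have nz: "c + M \<noteq> 0" "1 + M \<noteq> 0"
      using assms unfolding M_def
      by (metis Ints_minus Ints_of_nat add_eq_0_iff2) (metis of_nat_Suc of_nat_eq_0_iff nat.simps(3))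
    have g: "?g * ((1 + M) * (c + M)) = ?f * ((a - 1) * (b + M))"
    proof -
      have "pochhammer (a - 1) (Suc m) = (a - 1) * pochhammer a m"
        by (simp add: pochhammer_rec)
      then show ?thesis using nz
        by (simp add: gauss_fps_def pochhammer_Suc[of c] pochhammer_Suc[of b] pochhammer_Suc[of 1]
              M_def[symmetric])
    qed
    have f: "?f1 * ((1 + M) * (c + M)) = ?f * ((a + M) * (b + M))"
      using gauss_fps_nth_Suc[OF assms, of a b m] by (simp add: M_def)
    have "((1 + M + c - a) * ?f1 - (M + b) * ?f) * ((1 + M) * (c + M))
        = ((c - a) * ?g) * ((1 + M) * (c + M))"
      using f g by algebra
    then have "(1 + M + c - a) * ?f1 - (M + b) * ?f = (c - a) * ?g"
      using nz by simp
    then show ?thesis unfolding Suc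
      by (simp add: euler_op_nth ring_distribs M_def[symmetric]) (simp add: algebra_simps)
  qed
qed

text \<open>The hypergeometric equation with parameters \<open>a, b, \<alpha> + 1\<close> has the two local solutions
  \<open>x powr - \<beta> * kummer_fps \<alpha> \<beta> a b\<close> at the origin, for \<open>\<beta> = 0\<close> and \<open>\<beta> = \<alpha>\<close>; conjugating by
  \<open>x powr - \<beta>\<close> turns \<open>x * d / dx\<close> into \<^term>\<open>euler_op \<beta>\<close>.\<close>

definition kummer_fps :: "complex \<Rightarrow> complex \<Rightarrow> complex \<Rightarrow> complex \<Rightarrow> complex fps" where
  "kummer_fps \<alpha> \<beta> a b = gauss_fps (a - \<beta>) (b - \<beta>) (\<alpha> + 1 - 2 * \<beta>)"

lemma kummer_fps_commute: "kummer_fps \<alpha> \<beta> a b = kummer_fps \<alpha> \<beta> b a"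
  by (simp add: kummer_fps_def gauss_fps_commute)

lemma kummer_fps_nth_0: "fps_nth (kummer_fps \<alpha> \<beta> a b) 0 = 1"
  by (simp add: kummer_fps_def gauss_fps_nth_0)

lemma kummer_not_Ints:
  fixes \<alpha> \<beta> :: complex
  assumes "\<alpha> \<notin> \<int>" "\<beta> \<in> {0, \<alpha>}"
  shows "\<alpha> + 1 - 2 * \<beta> \<notin> \<int>"
proof
  assume *: "\<alpha> + 1 - 2 * \<beta> \<in> \<int>"
  have "\<alpha> = (\<alpha> + 1 - 2 * 0) - 1" "\<alpha> = 1 - (\<alpha> + 1 - 2 * \<alpha>)" by (simp_all add: algebra_simps)
  then show False using * assms by (metis Ints_1 Ints_diff empty_iff insert_iff)
qed

lemma kummer_fps_hypergeo_eq:
  assumes "\<alpha> \<notin> \<int>" "\<beta> \<in> {0, \<alpha>}"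
  shows "hypergeo_eq \<alpha> \<beta> a b (kummer_fps \<alpha> \<beta> a b)"
  unfolding hypergeo_eq_def
proof (rule fps_ext)
  fix n
  let ?F = "kummer_fps \<alpha> \<beta> a b"
  show "fps_nth ((1 - fps_X) * euler_op \<beta> (euler_op \<beta> ?F)) n =
     fps_nth ((fps_const (a + b) * fps_X - fps_const \<alpha>) * euler_op \<beta> ?F
       + fps_const (a * b) * fps_X * ?F) n"
  proof (cases n)
    case 0
    then show ?thesis using assms(2)
      by (auto simp: euler_op_nth ring_distribs mult.assoc)
  next
    case (Suc m)
    define M where "M = (of_nat m :: complex)"
    have f: "fps_nth ?F (Suc m) * ((1 + M) * (\<alpha> + 1 - 2 * \<beta> + M)) =
          fps_nth ?F m * ((a - \<beta> + M) * (b - \<beta> + M))"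
      using gauss_fps_nth_Suc[OF kummer_not_Ints[OF assms], of "a - \<beta>" "b - \<beta>" m]
      by (simp add: M_def kummer_fps_def)
    \<comment> \<open>The exponents \<open>- \<beta>\<close> at the origin are the roots
      \<open>r\<close> of \<open>r (r + \<alpha>) = 0\<close>.\<close>
    have q: "\<beta> * \<beta> = \<alpha> * \<beta>" using assms(2) by auto
    have "(1 + M - \<beta>) * ((1 + M - \<beta>) * fps_nth ?F (Suc m)) - (M - \<beta>) * ((M - \<beta>) * fps_nth ?F m)
      = (a + b) * ((M - \<beta>) * fps_nth ?F m) - \<alpha> * ((1 + M - \<beta>) * fps_nth ?F (Suc m))
        + a * b * fps_nth ?F m"
      using f q by algebra
    then show ?thesis unfolding Suc
      by (simp add: euler_op_nth left_diff_distrib mult.assoc M_def[symmetric] del: fps_const_add fps_const_mult)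
  qed
qed

text \<open>Once written with \<open>euler_op \<beta>\<close>, the operator on the left has
  coefficients free of \<open>\<beta>\<close>; only the scalar on the right depends on it. Hence one
  operator serves both solutions.\<close>

lemma kummer_fps_raise:
  assumes "\<alpha> \<notin> \<int>" "\<beta> \<in> {0, \<alpha>}"
  shows "(1 - fps_X) * euler_op \<beta> (kummer_fps \<alpha> \<beta> a b)
           + (fps_const (\<alpha> + 1 - a) - fps_const b * fps_X) * kummer_fps \<alpha> \<beta> a b
         = fps_const (\<alpha> + 1 - a - \<beta>) * kummer_fps \<alpha> \<beta> (a - 1) b"
proof -
  let ?F = "kummer_fps \<alpha> \<beta> a b"
  have "(1 - fps_X) * euler_op 0 ?F
           + (fps_const (\<alpha> + 1 - a - \<beta>) - fps_const (b - \<beta>) * fps_X) * ?F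
         = fps_const (\<alpha> + 1 - a - \<beta>) * kummer_fps \<alpha> \<beta> (a - 1) b"
    using gauss_fps_raise[OF kummer_not_Ints[OF assms], of "a - \<beta>" "b - \<beta>"]
    by (simp add: kummer_fps_def algebra_simps)
  moreover have "euler_op 0 ?F = euler_op \<beta> ?F + fps_const \<beta> * ?F"
    using euler_op_shift[of 0 \<beta> ?F] by simp
  moreover have "fps_const (\<alpha> + 1 - a - \<beta>) = fps_const (\<alpha> + 1 - a) - fps_const \<beta>"
    "fps_const (b - \<beta>) = fps_const b - fps_const \<beta>" by simp_all
  ultimately show ?thesis by algebra
qed

lemma kummer_fps_lower:
  "euler_op \<beta> (kummer_fps \<alpha> \<beta> a b) + fps_const b * kummer_fps \<alpha> \<beta> a b
     = fps_const (b - \<beta>) * kummer_fps \<alpha> \<beta> a (b + 1)"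
proof -
  let ?F = "kummer_fps \<alpha> \<beta> a b"
  have "euler_op 0 ?F + fps_const (b - \<beta>) * ?F = fps_const (b - \<beta>) * kummer_fps \<alpha> \<beta> a (b + 1)"
    using gauss_fps_lower[of "a - \<beta>" "b - \<beta>" "\<alpha> + 1 - 2 * \<beta>"]
    by (simp add: kummer_fps_def algebra_simps)
  moreover have "euler_op 0 ?F = euler_op \<beta> ?F + fps_const \<beta> * ?F"
    using euler_op_shift[of 0 \<beta> ?F] by simp
  moreover have "fps_const (b - \<beta>) = fps_const b - fps_const \<beta>" by simp
  ultimately show ?thesis by algebra
qed

text \<open>Composing the shifts to \<open>b + 1\<close> and \<open>a - 1\<close> gives a
  second-order operator. The hypergeometric equation removes its leading term, and the remaining
  derivative keeps a coefficient divisible by \<open>1 - x\<close>.\<close>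

lemma kummer_fps_exchange:
  assumes "\<alpha> \<notin> \<int>" "\<beta> \<in> {0, \<alpha>}"
  shows "fps_const (1 + b - a) * (1 - fps_X) * euler_op \<beta> (kummer_fps \<alpha> \<beta> a b)
           + (fps_const (b * (\<alpha> + 1 - a)) - fps_const (b * (b + 1 - a)) * fps_X) * kummer_fps \<alpha> \<beta> a b
         = fps_const ((b - \<beta>) * (\<alpha> + 1 - a - \<beta>)) * kummer_fps \<alpha> \<beta> (a - 1) (b + 1)"
proof -
  let ?F = "kummer_fps \<alpha> \<beta> a b" and ?G = "kummer_fps \<alpha> \<beta> a (b + 1)"
    and ?H = "kummer_fps \<alpha> \<beta> (a - 1) (b + 1)"
  define A B C c where ABC: "A = fps_const a" "B = fps_const b" "C = fps_const \<alpha>" "c = fps_const \<beta>"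
  define F1 F2 where F: "F1 = euler_op \<beta> ?F" "F2 = euler_op \<beta> F1"
  have const_simps: "fps_const (1 + b - a) = 1 + B - A" "fps_const (b * (\<alpha> + 1 - a)) = B * (C + 1 - A)"
    "fps_const (b * (b + 1 - a)) = B * (B + 1 - A)"
    "fps_const ((b - \<beta>) * (\<alpha> + 1 - a - \<beta>)) = (B - c) * (C + 1 - A - c)"
    "fps_const (\<alpha> + 1 - a) = C + 1 - A" "fps_const (b + 1) = B + 1"
    "fps_const (\<alpha> + 1 - a - \<beta>) = C + 1 - A - c" "fps_const (b - \<beta>) = B - c"
    "fps_const (a + b) = A + B" "fps_const (a * b) = A * B"
    by (simp_all add: ABC flip: fps_const_1_eq_1)
  have lower: "F1 + B * ?F = (B - c) * ?G"
    using kummer_fps_lower[of \<beta> \<alpha> a b] by (simp add: ABC F)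
  have "euler_op \<beta> (F1 + B * ?F) = F2 + B * F1"
    by (simp add: euler_op_add euler_op_mult_left F ABC euler_op_const)
  moreover have "euler_op \<beta> ((B - c) * ?G) = (B - c) * euler_op \<beta> ?G"
    by (simp add: euler_op_mult_left euler_op_const ABC)
  ultimately have lower': "F2 + B * F1 = (B - c) * euler_op \<beta> ?G"
    using lower by simp
  \<comment> \<open>The second shift acts on the result of the first, hence at \<open>b + 1\<close>;
    multiplied by \<open>B - c\<close>, it allows \<open>lower\<close> and \<open>lower'\<close> to
    eliminate \<open>?G\<close>.\<close>
  have raise: "(1 - fps_X) * euler_op \<beta> ?G + (C + 1 - A - (B + 1) * fps_X) * ?G = (C + 1 - A - c) * ?H"
    using kummer_fps_raise[OF assms, of a "b + 1"] unfolding const_simps .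
  have ode: "(1 - fps_X) * F2 = ((A + B) * fps_X - C) * F1 + A * B * fps_X * ?F"
    using kummer_fps_hypergeo_eq[OF assms, of a b]
    unfolding hypergeo_eq_def const_simps F[symmetric] ABC[symmetric] .
  show ?thesis unfolding const_simps F[symmetric]
    using lower lower' raise ode by algebra
qed


section \<open>Radius of convergence of the Gauss series\<close>

text \<open>Ratio test; non-integral \<open>a\<close> and \<open>b\<close> keep every coefficient
  nonzero, so the quotients are meaningful. This permits evaluating the formal product of two series
  inside the unit disc.\<close>

lemma fps_conv_radius_gauss_fps:
  assumes "a \<notin> \<int>" "b \<notin> \<int>" "c \<notin> \<int>"
  shows "fps_conv_radius (gauss_fps a b c) = 1"
  unfolding fps_conv_radius_def
proof (rule conv_radius_ratio_limit_nonzero)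
  let ?f = "fps_nth (gauss_fps a b c)"
  have nz: "z + of_nat n \<noteq> 0" if "z \<notin> \<int>" for z :: complex and n
    using that by (metis Ints_minus Ints_of_nat add_eq_0_iff2)
  have "?f n \<noteq> 0" for n
  proof -
    have "pochhammer z n \<noteq> 0" if "z \<notin> \<int>" for z :: complex
      using that by (auto simp: pochhammer_eq_0_iff)
    moreover have "pochhammer (1::complex) n \<noteq> 0"
      by (metis fact_nonzero pochhammer_fact)
    ultimately show ?thesis using assms by (simp add: gauss_fps_def)
  qed
  then have ratio: "?f n / ?f (Suc n) =
      (1 + of_nat n) * (c + of_nat n) / ((a + of_nat n) * (b + of_nat n))" for n
    using gauss_fps_nth_Suc[OF assms(3), of a b n] nz[OF assms(1), of n] nz[OF assms(2), of n]
    by (simp add: divide_simps mult_ac)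
  have lim: "(\<lambda>n. of_nat n / (z + of_nat n)) \<longlonglongrightarrow> 1" for z :: complex
  proof -
    have "(\<lambda>n. z * (1 / of_nat n) + 1) \<longlonglongrightarrow> z * 0 + 1"
      by (intro tendsto_intros lim_1_over_n)
    then have "(\<lambda>n. inverse (z * (1 / of_nat n) + 1)) \<longlonglongrightarrow> inverse (z * 0 + 1)"
      by (rule tendsto_inverse) simp
    moreover have "\<forall>\<^sub>F n in sequentially. inverse (z * (1 / of_nat n) + 1) = of_nat n / (z + of_nat n)"
      using eventually_gt_at_top[of 0] by eventually_elim (simp add: field_simps)
    ultimately show ?thesis by (simp add: tendsto_cong)
  qed
  have "(\<lambda>n. (of_nat n / (a + of_nat n)) * (of_nat n / (b + of_nat n)) /
      ((of_nat n / (1 + of_nat n)) * (of_nat n / (c + of_nat n)))) \<longlonglongrightarrow> 1 * 1 / (1 * 1)"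
    by (intro tendsto_intros lim) simp
  moreover have "\<forall>\<^sub>F n in sequentially. (of_nat n / (a + of_nat n)) * (of_nat n / (b + of_nat n)) /
      ((of_nat n / (1 + of_nat n)) * (of_nat n / (c + of_nat n))) = ?f n / ?f (Suc n)"
    using eventually_gt_at_top[of 0] by eventually_elim (simp add: ratio)
  ultimately have "(\<lambda>n. ?f n / ?f (Suc n)) \<longlonglongrightarrow> 1"
    by (simp add: tendsto_cong)
  from tendsto_norm[OF this] show "(\<lambda>n. norm (?f n) / norm (?f (Suc n))) \<longlonglongrightarrow> 1"
    by (simp add: norm_divide)
qed simp_all

section \<open>The symmetric square of the equation as a first-order system\<close>

locale hypergeo_pair =
  fixes \<alpha> a b :: complex and u v :: "complex fps"
  assumes eq_u: "hypergeo_eq \<alpha> 0 a b u" and eq_v: "hypergeo_eq \<alpha> \<alpha> a b v"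
begin

text \<open>Up to \<open>x powr - \<alpha>\<close>, these are the product of two solutions, its
  Euler derivative, and the product of their derivatives. The factor \<open>1 - x\<close> in
  \<open>W\<close> cancels the pole which that last product has at 1 already for
  \<open>s = t = 0\<close>.\<close>

definition P where "P = u * v"
definition Q where "Q = euler_op \<alpha> P"
definition W where "W = (1 - fps_X) * euler_op 0 u * euler_op \<alpha> v"
text \<open>This is \<open>(1 - x)\<close> times the square of the Wronskian of the two solutions.\<close>
definition K where "K = (1 - fps_X) * Q\<^sup>2 - 4 * P * W"

lemma Q_eq: "Q = euler_op 0 u * v + u * euler_op \<alpha> v"
  unfolding Q_def P_def using euler_op_mult[of 0 \<alpha> u v] by simp

lemma euler_P: "euler_op 0 P = Q + fps_const \<alpha> * P"
  unfolding Q_def using euler_op_shift[of 0 \<alpha> P] by simp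

text \<open>The product rule, with second derivatives eliminated by the two equations. With
  \<open>euler_P\<close> and \<open>euler_W\<close> it closes the system for \<open>P\<close>,
  \<open>Q\<close>, \<open>W\<close>; the summand with factor \<open>\<alpha> * (1 - x)\<close>
  comes from differentiating \<open>Q\<close>, of weight \<open>\<alpha>\<close>, with weight
  0.\<close>

lemma euler_Q:
  "(1 - fps_X) * euler_op 0 Q = 2 * W + (fps_const (a + b) * fps_X - fps_const \<alpha>) * Q
     + 2 * fps_const (a * b) * fps_X * P + fps_const \<alpha> * (1 - fps_X) * Q"
proof -
  let ?u1 = "euler_op 0 u" and ?v1 = "euler_op \<alpha> v"
  have v: "euler_op 0 w = euler_op \<alpha> w + fps_const \<alpha> * w" for w
    using euler_op_shift[of 0 \<alpha> w] by simp
  have "euler_op 0 Q = euler_op 0 ?u1 * v + ?u1 * (?v1 + fps_const \<alpha> * v)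
          + (?u1 * ?v1 + u * (euler_op \<alpha> ?v1 + fps_const \<alpha> * ?v1))"
    unfolding Q_eq by (simp only: euler_op_add euler_op_mult_left v[of v] v[of ?v1])
  then have "(1 - fps_X) * euler_op 0 Q =
      ((1 - fps_X) * euler_op 0 ?u1) * v + u * ((1 - fps_X) * euler_op \<alpha> ?v1)
        + 2 * W + fps_const \<alpha> * (1 - fps_X) * Q"
    unfolding W_def Q_eq by algebra
  also have "\<dots> = 2 * W + (fps_const (a + b) * fps_X - fps_const \<alpha>) * Q
     + 2 * fps_const (a * b) * fps_X * P + fps_const \<alpha> * (1 - fps_X) * Q"
    unfolding eq_u[unfolded hypergeo_eq_def] eq_v[unfolded hypergeo_eq_def]
    unfolding Q_eq P_def by algebra
  finally show ?thesis .
qed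

lemma euler_W:
  "(1 - fps_X) * euler_op 0 W =
     - fps_X * W + 2 * (fps_const (a + b) * fps_X - fps_const \<alpha>) * W
     + fps_const (a * b) * fps_X * (1 - fps_X) * Q + fps_const \<alpha> * (1 - fps_X) * W"
proof -
  let ?u1 = "euler_op 0 u" and ?v1 = "euler_op \<alpha> v"
  have v: "euler_op 0 ?v1 = euler_op \<alpha> ?v1 + fps_const \<alpha> * ?v1"
    using euler_op_shift[of 0 \<alpha> ?v1] by simp
  have X: "euler_op 0 (1 - fps_X) = - fps_X"
    by (simp add: euler_op_def)
  have "euler_op 0 W = (- fps_X * ?u1 + (1 - fps_X) * euler_op 0 ?u1) * ?v1
      + (1 - fps_X) * ?u1 * (euler_op \<alpha> ?v1 + fps_const \<alpha> * ?v1)"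
    unfolding W_def by (simp only: euler_op_mult_left[of 0] v X)
  then have "(1 - fps_X) * euler_op 0 W = - fps_X * W
      + (1 - fps_X) * (((1 - fps_X) * euler_op 0 ?u1) * ?v1 + ?u1 * ((1 - fps_X) * euler_op \<alpha> ?v1))
      + fps_const \<alpha> * (1 - fps_X) * W"
    unfolding W_def by algebra
  also have "\<dots> = - fps_X * W + 2 * (fps_const (a + b) * fps_X - fps_const \<alpha>) * W
     + fps_const (a * b) * fps_X * (1 - fps_X) * Q + fps_const \<alpha> * (1 - fps_X) * W"
    unfolding eq_u[unfolded hypergeo_eq_def] eq_v[unfolded hypergeo_eq_def]
    unfolding Q_eq W_def by algebra
  finally show ?thesis .
qed

text \<open>Abel's identity for the Wronskian: \<open>K\<close> is a constant times
  \<open>1 - x\<close> to the power \<open>2 * \<alpha> + 1 - 2 * (a + b)\<close>, which is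
  \<open>2 * (s + t)\<close> in the application.\<close>

lemma euler_K:
  "(1 - fps_X) * euler_op 0 K = fps_const (2 * (a + b) - 2 * \<alpha> - 1) * fps_X * K"
proof -
  have X: "euler_op 0 (1 - fps_X) = - fps_X" "euler_op 0 4 = 0"
    by (simp_all add: euler_op_def)
  have diff: "euler_op 0 (F - G) = euler_op 0 F - euler_op 0 G" for F G
    by (simp add: euler_op_def algebra_simps)
  have "euler_op 0 K = - fps_X * (Q * Q) + (1 - fps_X) * (euler_op 0 Q * Q + Q * euler_op 0 Q)
      - ((0 * P + 4 * euler_op 0 P) * W + 4 * P * euler_op 0 W)"
    unfolding K_def diff[of _ "4 * P * W"] power2_eq_square euler_op_mult_left[of 0] X ..
  then have "(1 - fps_X) * euler_op 0 K = - fps_X * (1 - fps_X) * Q\<^sup>2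
      + 2 * (1 - fps_X) * Q * ((1 - fps_X) * euler_op 0 Q)
      - 4 * (1 - fps_X) * euler_op 0 P * W - 4 * P * ((1 - fps_X) * euler_op 0 W)"
    by algebra
  also have "\<dots> = (2 * fps_const (a + b) - 2 * fps_const \<alpha> - 1) * fps_X * K"
    unfolding euler_P euler_Q euler_W K_def by algebra
  also have "2 * fps_const (a + b) - 2 * fps_const \<alpha> - 1 = fps_const (2 * (a + b) - 2 * \<alpha> - 1)"
    by (simp add: numeral_fps_const flip: fps_const_1_eq_1)
  finally show ?thesis .
qed

section \<open>Coefficient recurrences, the case \<open>s = t = 0\<close>, and constraints on the
  degree\<close>

lemma Q_nth: "fps_nth Q n = (of_nat n - \<alpha>) * fps_nth P n"
  by (simp add: Q_def euler_op_nth)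

lemma W_nth_0: "fps_nth W 0 = 0"
  by (simp add: W_def euler_op_nth)

lemma W_nth_Suc:
  "2 * fps_nth W (Suc n) = of_nat (Suc n) * fps_nth Q (Suc n)
     - (of_nat n - \<alpha> + a + b) * fps_nth Q n - 2 * (a * b) * fps_nth P n"
  using arg_cong[OF euler_Q, of "\<lambda>F. fps_nth F (Suc n)"]
  by (simp add: euler_op_nth left_diff_distrib right_diff_distrib mult.assoc numeral_fps_const
      del: fps_const_add fps_const_mult)
     (simp add: algebra_simps)

lemma W_nth_rec:
  "(of_nat (Suc n) + \<alpha>) * fps_nth W (Suc n) =
     (of_nat n - 1 + 2 * (a + b) - \<alpha>) * fps_nth W n
     + a * b * (fps_nth Q n - (if n = 0 then 0 else fps_nth Q (n - 1)))"
  using arg_cong[OF euler_W, of "\<lambda>F. fps_nth F (Suc n)"]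
  by (cases "n = 0"; simp add: euler_op_nth left_diff_distrib right_diff_distrib mult.assoc numeral_fps_const
      del: fps_const_add fps_const_mult)
     (simp_all add: algebra_simps)

lemma K_nth_Suc:
  "of_nat (Suc n) * fps_nth K (Suc n) =
     (of_nat n + (2 * (a + b) - 2 * \<alpha> - 1)) * fps_nth K n"
  using arg_cong[OF euler_K, of "\<lambda>F. fps_nth F (Suc n)"]
  by (simp add: euler_op_nth left_diff_distrib mult.assoc del: fps_const_add fps_const_mult fps_const_sub)
     (simp add: algebra_simps)

text \<open>\<open>W_nth_rec\<close> determines the next coefficient of \<open>W\<close>, then
  \<open>W_nth_Suc\<close> that of \<open>Q\<close> and so of \<open>P\<close>; the divisors
  \<open>n + \<alpha>\<close> and \<open>n - \<alpha>\<close> never vanish.\<close>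

lemma base_case:
  assumes ab: "a = \<alpha> / 2" "b = (\<alpha> + 1) / 2" and uv: "fps_nth u 0 = 1" "fps_nth v 0 = 1"
    and \<alpha>: "\<alpha> \<notin> \<int>"
  shows "P = 1" "W = fps_const (- \<alpha>\<^sup>2 / 4) * fps_X"
proof -
  have plus: "of_nat n + \<alpha> \<noteq> 0" and minus: "of_nat n - \<alpha> \<noteq> 0" for n
    using \<alpha> by (metis Ints_minus Ints_of_nat add_eq_0_iff) (use \<alpha> in auto)
  have "fps_nth P n = (if n = 0 then 1 else 0) \<and> fps_nth W n = (if n = 1 then - \<alpha>\<^sup>2 / 4 else 0)" for n
  proof (induction n rule: less_induct)
    case (less n)
    show ?case
    proof (cases n)
      case 0
      then show ?thesis using uv by (simp add: W_nth_0 P_def)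
    next
      case (Suc m)
      have IH: "fps_nth P k = (if k = 0 then 1 else 0)" "fps_nth W k = (if k = 1 then - \<alpha>\<^sup>2 / 4 else 0)"
        if "k \<le> m" for k
        using less.IH[of k] that Suc by auto
      have W: "fps_nth W (Suc m) = (if m = 0 then - \<alpha>\<^sup>2 / 4 else 0)"
      proof -
        \<comment> \<open>Coefficient 1 of \<open>W\<close> comes from \<open>Q\<close> at 0; for
          \<open>m = 1\<close> the contributions of \<open>W\<close> at 1 and \<open>Q\<close> at 0
          cancel; afterwards every term is zero.\<close>
        consider "m = 0" | "m = 1" | "m \<ge> 2" by linarith
        then have "(of_nat (Suc m) + \<alpha>) * fps_nth W (Suc m) =
            (of_nat (Suc m) + \<alpha>) * (if m = 0 then - \<alpha>\<^sup>2 / 4 else 0)"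
          unfolding W_nth_rec
          by cases (use IH in \<open>auto simp: Q_nth ab field_simps power2_eq_square\<close>)
        then show ?thesis using plus[of "Suc m"] by (simp only: mult_left_cancel not_False_eq_True)
      qed
      from W_nth_Suc[of m, unfolded W] IH[of m] have "of_nat (Suc m) * fps_nth Q (Suc m) = 0"
        by (cases "m = 0") (simp_all add: Q_nth[of m] Q_nth[of 0] ab field_simps power2_eq_square)
      then have "fps_nth P (Suc m) = 0"
        using minus[of "Suc m"] by (simp add: Q_nth del: of_nat_Suc)
      with W show ?thesis by (simp add: Suc)
    qed
  qed
  then show "P = 1" "W = fps_const (- \<alpha>\<^sup>2 / 4) * fps_X"
    by (simp_all add: fps_eq_iff)
qed

lemma nth_beyond_degree:
  assumes p: "P = fps_of_poly p"
    and n: "degree p < n"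
  shows "fps_nth P n = 0" "fps_nth Q n = 0" "fps_nth W (Suc n) = 0"
proof -
  show 1: "fps_nth P n = 0" using n by (simp add: p coeff_eq_0)
  then show 2: "fps_nth Q n = 0" by (simp add: Q_nth)
  have "fps_nth Q (Suc n) = 0" using n by (simp add: Q_nth p coeff_eq_0)
  then show "fps_nth W (Suc n) = 0"
    using W_nth_Suc[of n] 1 2 by simp
qed

text \<open>Solutions behave at infinity like \<open>x powr - a\<close> and
  \<open>x powr - b\<close>, so products of two have exponents \<open>- 2 * a\<close>,
  \<open>- 2 * b\<close> and \<open>- (a + b)\<close>; the leading exponent of
  \<open>x powr - \<alpha> * P\<close> is \<open>m\<close>. Two relations between the top
  coefficients of \<open>P\<close> and \<open>W\<close> prove it formally.\<close>

lemma indicial_at_infinity: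
  assumes p: "P = fps_of_poly p" "p \<noteq> 0"
  defines "m \<equiv> of_nat (degree p) - \<alpha>"
  shows "(m + 2 * a) * (m + 2 * b) * (m + a + b) = 0"
proof -
  let ?e = "degree p"
  let ?w = "fps_nth W (Suc ?e)" and ?p = "fps_nth P ?e"
  have Q: "fps_nth Q ?e = m * ?p" by (simp add: Q_nth m_def)
  have "2 * ?w = - (m + a + b) * (m * ?p) - 2 * (a * b) * ?p"
    using W_nth_Suc[of ?e, folded m_def] nth_beyond_degree(2)[OF p(1) lessI] Q
    by algebra
  moreover have "0 = (m + 2 * (a + b)) * ?w - a * b * (m * ?p)"
    using W_nth_rec[of "Suc ?e"] nth_beyond_degree[OF p(1), of "Suc ?e"]
    by (simp add: Q) (simp add: m_def algebra_simps)
  ultimately have "((m + 2 * a) * (m + 2 * b) * (m + a + b)) * ?p = 0"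
    by algebra
  moreover have "?p \<noteq> 0" using p by simp
  ultimately show ?thesis by simp
qed

text \<open>\<open>K\<close> is a nonzero multiple of the \<open>N\<close>-th power of
  \<open>1 - x\<close>, while its definition through \<open>P\<close>, \<open>Q\<close>,
  \<open>W\<close> bounds its degree by \<open>2 * degree p + 1\<close>.\<close>

lemma degree_lower_bound:
  assumes p: "P = fps_of_poly p" and W: "polynomial_fps W"
    and \<alpha>: "\<alpha> \<noteq> 0" and P0: "fps_nth P 0 \<noteq> 0"
    and N: "2 * (a + b) - 2 * \<alpha> - 1 = - of_nat N"
  shows "N \<le> 2 * degree p + 1"
proof -
  let ?e = "degree p"
  obtain w where w: "W = fps_of_poly w" using W by auto
  obtain q where q: "Q = fps_of_poly q"
    using polynomial_fps_euler_op[of P \<alpha>] p unfolding Q_def by auto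
  define k where "k = [:1, -1:] * q\<^sup>2 - 4 * p * w"
  have k: "K = fps_of_poly k"
  proof -
    have "fps_of_poly [:1, -1 :: complex:] = 1 - fps_X"
      by (rule fps_ext) (simp add: coeff_pCons split: nat.split)
    then show ?thesis
      by (simp add: K_def k_def p q w fps_of_poly_diff fps_of_poly_mult power2_eq_square)
  qed
  have "degree q \<le> ?e"
  proof (rule degree_le, intro allI impI)
    fix n assume "?e < n"
    then show "coeff q n = 0" using nth_beyond_degree(2)[OF p, of n] by (simp add: q)
  qed
  moreover have "degree w \<le> Suc ?e"
  proof (rule degree_le, intro allI impI)
    fix n assume "Suc ?e < n"
    then show "coeff w n = 0"
      using nth_beyond_degree(3)[OF p, of "n - 1"] by (cases n) (simp_all add: w)
  qed
  moreover have "degree ([:1, -1:] * q\<^sup>2) \<le> 1 + 2 * degree q"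
    by (rule order.trans[OF degree_mult_le]) (simp add: degree_power_le mult.commute)
  moreover have "degree (4 * p * w) \<le> ?e + degree w"
    using degree_mult_le[of "4 * p" w] degree_mult_le[of 4 p] by simp
  ultimately have deg: "degree k \<le> 2 * ?e + 1"
    unfolding k_def by (intro degree_diff_le) auto
  \<comment> \<open>The recurrence factor \<open>n - N\<close> first vanishes at
    \<open>n = N\<close>, so no coefficient up to index \<open>N\<close> is lost.\<close>
  have "n \<le> N \<Longrightarrow> fps_nth K n \<noteq> 0" for n
  proof (induction n)
    case 0
    have "fps_nth K 0 = (fps_nth Q 0)\<^sup>2"
      by (simp add: K_def W_nth_0 power2_eq_square)
    then show ?case using \<alpha> P0 by (simp add: Q_nth)
  next
    case (Suc n)
    have "of_nat (Suc n) * fps_nth K (Suc n) = (of_nat n - of_nat N) * fps_nth K n"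
      using K_nth_Suc[of n] unfolding N by simp
    moreover have "(of_nat n - of_nat N :: complex) \<noteq> 0" using Suc.prems by simp
    ultimately show ?case using Suc by auto
  qed
  from this[of N] have "coeff k N \<noteq> 0" by (simp add: k)
  then show ?thesis using le_degree deg by (meson order.trans)
qed

end

section \<open>Propagation of polynomiality along contiguity operators\<close>

definition polynomial_pair :: "complex \<Rightarrow> complex fps \<Rightarrow> complex fps \<Rightarrow> bool" where
  "polynomial_pair \<alpha> u v \<longleftrightarrow>
     polynomial_fps (u * v) \<and> polynomial_fps ((1 - fps_X) * euler_op 0 u * euler_op \<alpha> v)"

text \<open>The factor \<open>1 - x\<close> on the derivative absorbs the leading coefficient of the
  equation, so differentiating stays within combinations of \<open>F\<close> and its derivative
  without denominators.\<close>

lemma euler_op_operator: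
  assumes "hypergeo_eq \<alpha> \<beta> a b F"
  shows "euler_op \<beta> (q * (1 - fps_X) * euler_op \<beta> F + p * F) =
    (euler_op 0 p + q * fps_const (a * b) * fps_X) * F +
    (p + euler_op 0 (q * (1 - fps_X)) + q * (fps_const (a + b) * fps_X - fps_const \<alpha>)) * euler_op \<beta> F"
proof -
  have "euler_op \<beta> (q * (1 - fps_X) * euler_op \<beta> F + p * F) =
      euler_op 0 (q * (1 - fps_X)) * euler_op \<beta> F + q * ((1 - fps_X) * euler_op \<beta> (euler_op \<beta> F))
      + (euler_op 0 p * F + p * euler_op \<beta> F)"
    unfolding euler_op_add euler_op_mult_left[of \<beta> "q * (1 - fps_X)"] euler_op_mult_left[of \<beta> p]
    by (simp only: mult.assoc)
  also have "\<dots> = (euler_op 0 p + q * fps_const (a * b) * fps_X) * F +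
    (p + euler_op 0 (q * (1 - fps_X)) + q * (fps_const (a + b) * fps_X - fps_const \<alpha>)) * euler_op \<beta> F"
    unfolding assms[unfolded hypergeo_eq_def] by algebra
  finally show ?thesis .
qed

text \<open>As \<open>p\<close> and \<open>q\<close> are common to both solutions, mixed terms occur
  only in the symmetric combination \<open>Q\<close>, so the new products are polynomial
  combinations of \<open>P\<close>, \<open>Q\<close>, \<open>W\<close>.\<close>

lemma polynomial_pair_operator:
  assumes eqs: "hypergeo_eq \<alpha> 0 a b u" "hypergeo_eq \<alpha> \<alpha> a b v"
    and pair: "polynomial_pair \<alpha> u v" and pq: "polynomial_fps p" "polynomial_fps q"
    and u': "q * (1 - fps_X) * euler_op 0 u + p * u = fps_const k * u'" and k: "k \<noteq> 0"
    and v': "q * (1 - fps_X) * euler_op \<alpha> v + p * v = fps_const l * v'" and l: "l \<noteq> 0"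
  shows "polynomial_pair \<alpha> u' v'"
proof -
  interpret hypergeo_pair \<alpha> a b u v using eqs by unfold_locales
  have P: "polynomial_fps P" and W: "polynomial_fps W"
    using pair by (simp_all add: polynomial_pair_def P_def W_def)
  then have Q: "polynomial_fps Q" unfolding Q_def by (intro polynomial_fps_intros)
  define r where "r = euler_op 0 p + q * fps_const (a * b) * fps_X"
  define s where "s = p + euler_op 0 (q * (1 - fps_X)) + q * (fps_const (a + b) * fps_X - fps_const \<alpha>)"
  have r: "polynomial_fps r" unfolding r_def by (intro polynomial_fps_intros pq)
  have s: "polynomial_fps s" unfolding s_def by (intro polynomial_fps_intros pq)
  have du: "fps_const k * euler_op 0 u' = r * u + s * euler_op 0 u"
    using euler_op_operator[OF eqs(1), of q p] unfolding u' r_def s_def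
    by (simp add: euler_op_mult_left euler_op_const)
  have dv: "fps_const l * euler_op \<alpha> v' = r * v + s * euler_op \<alpha> v"
    using euler_op_operator[OF eqs(2), of q p] unfolding v' r_def s_def
    by (simp add: euler_op_mult_left[of \<alpha>] euler_op_const)
  have scale: "polynomial_fps F" if "polynomial_fps (fps_const k * fps_const l * F)" for F
  proof -
    have "F = fps_const (inverse (k * l)) * (fps_const k * fps_const l * F)"
      using k l by (simp add: mult.assoc[symmetric]) (simp add: field_simps)
    then show ?thesis using that by (metis polynomial_fps_const polynomial_fps_mult)
  qed
  have "fps_const k * fps_const l * (u' * v') = (fps_const k * u') * (fps_const l * v')"
    by (simp only: mult_ac)
  also have "\<dots> = q * q * (1 - fps_X) * W + p * q * (1 - fps_X) * Q + p * p * P"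
    unfolding u'[symmetric] v'[symmetric] W_def Q_eq P_def by algebra
  finally have 1: "polynomial_fps (fps_const k * fps_const l * (u' * v'))"
    by (simp only:) (intro polynomial_fps_intros pq P Q W)
  have "fps_const k * fps_const l * ((1 - fps_X) * euler_op 0 u' * euler_op \<alpha> v') =
      (1 - fps_X) * (fps_const k * euler_op 0 u') * (fps_const l * euler_op \<alpha> v')"
    by (simp only: mult_ac)
  also have "\<dots> = (1 - fps_X) * r * r * P + (1 - fps_X) * r * s * Q + s * s * W"
    unfolding du dv W_def Q_eq P_def by algebra
  finally have 2: "polynomial_fps (fps_const k * fps_const l * ((1 - fps_X) * euler_op 0 u' * euler_op \<alpha> v'))"
    by (simp only:) (intro polynomial_fps_intros r s P Q W)
  show ?thesis unfolding polynomial_pair_def using scale[OF 1] scale[OF 2] by blast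
qed

abbreviation kummer_polynomial :: "complex \<Rightarrow> complex \<Rightarrow> complex \<Rightarrow> bool" where
  "kummer_polynomial \<alpha> a b \<equiv> polynomial_pair \<alpha> (kummer_fps \<alpha> 0 a b) (kummer_fps \<alpha> \<alpha> a b)"

lemma kummer_polynomial_commute: "kummer_polynomial \<alpha> a b = kummer_polynomial \<alpha> b a"
  by (simp add: kummer_fps_commute)

text \<open>For these \<open>\<beta>\<close>, \<open>2 * (a - \<beta>)\<close> is
  \<open>\<alpha>\<close> or \<open>- \<alpha>\<close> plus an integer.\<close>

lemma shift_nonzero:
  fixes \<alpha> \<beta> a k :: complex
  assumes "\<alpha> \<notin> \<int>" "\<beta> \<in> {0, \<alpha>}" "2 * a - \<alpha> \<in> \<int>" "k \<in> \<int>"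
  shows "a - \<beta> \<noteq> k"
proof
  assume *: "a - \<beta> = k"
  have "\<alpha> = 2 * (a - 0) - (2 * a - \<alpha>)" "\<alpha> = (2 * a - \<alpha>) - 2 * (a - \<alpha>)" by (simp_all add: algebra_simps)
  moreover have "2 * k \<in> \<int>" using assms(4) by simp
  ultimately show False using * assms by (metis Ints_diff empty_iff insert_iff)
qed

lemma kummer_polynomial_raise:
  assumes \<alpha>: "\<alpha> \<notin> \<int>" and a: "2 * a - \<alpha> \<in> \<int>" and pair: "kummer_polynomial \<alpha> a b"
  shows "kummer_polynomial \<alpha> (a - 1) b"
proof (rule polynomial_pair_operator[where q = 1 and p = "fps_const (\<alpha> + 1 - a) - fps_const b * fps_X"
      and k = "\<alpha> + 1 - a - 0" and l = "\<alpha> + 1 - a - \<alpha>"])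
  show "hypergeo_eq \<alpha> 0 a b (kummer_fps \<alpha> 0 a b)" "hypergeo_eq \<alpha> \<alpha> a b (kummer_fps \<alpha> \<alpha> a b)"
    using \<alpha> by (auto intro: kummer_fps_hypergeo_eq)
  \<comment> \<open>\<open>\<alpha> + 1 - a - \<beta>\<close> equals
    \<open>1 - (a - (\<alpha> - \<beta>))\<close>, so each case uses \<open>shift_nonzero\<close> at
    the other exponent.\<close>
  show "\<alpha> + 1 - a - 0 \<noteq> 0" "\<alpha> + 1 - a - \<alpha> \<noteq> 0"
    using shift_nonzero[OF \<alpha> _ a, of \<alpha> 1] shift_nonzero[OF \<alpha> _ a, of 0 1] by (auto simp: algebra_simps)
qed (use pair kummer_fps_raise[OF \<alpha>, of _ a b] in \<open>auto intro!: polynomial_fps_intros\<close>)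

lemma kummer_polynomial_exchange:
  assumes \<alpha>: "\<alpha> \<notin> \<int>" and a: "2 * a - \<alpha> \<in> \<int>" and b: "2 * b - \<alpha> \<in> \<int>"
    and pair: "kummer_polynomial \<alpha> a b"
  shows "kummer_polynomial \<alpha> (a - 1) (b + 1)"
proof (rule polynomial_pair_operator[where q = "fps_const (1 + b - a)"
      and p = "fps_const (b * (\<alpha> + 1 - a)) - fps_const (b * (b + 1 - a)) * fps_X"
      and k = "(b - 0) * (\<alpha> + 1 - a - 0)" and l = "(b - \<alpha>) * (\<alpha> + 1 - a - \<alpha>)"])
  show "hypergeo_eq \<alpha> 0 a b (kummer_fps \<alpha> 0 a b)" "hypergeo_eq \<alpha> \<alpha> a b (kummer_fps \<alpha> \<alpha> a b)"
    using \<alpha> by (auto intro: kummer_fps_hypergeo_eq)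
  have "\<alpha> + 1 - a - 0 \<noteq> 0" "\<alpha> + 1 - a - \<alpha> \<noteq> 0"
    using shift_nonzero[OF \<alpha> _ a, of \<alpha> 1] shift_nonzero[OF \<alpha> _ a, of 0 1] by (auto simp: algebra_simps)
  moreover have "b - 0 \<noteq> 0" "b - \<alpha> \<noteq> 0"
    using shift_nonzero[OF \<alpha> _ b, of \<alpha> 0] shift_nonzero[OF \<alpha> _ b, of 0 0] by auto
  ultimately show "(b - 0) * (\<alpha> + 1 - a - 0) \<noteq> 0" "(b - \<alpha>) * (\<alpha> + 1 - a - \<alpha>) \<noteq> 0"
    by (simp_all only: mult_eq_0_iff simp_thms)
qed (use pair kummer_fps_exchange[OF \<alpha>, of _ b a] in \<open>auto intro!: polynomial_fps_intros\<close>)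

text \<open>These are the parameters for \<open>s = n - j\<close>, \<open>t = j\<close>. Exchanges
  starting at the origin cover the line \<open>s + t = 0\<close>, after which \<open>s\<close> is
  raised \<open>n\<close> times.\<close>

lemma kummer_polynomial_half_integers:
  assumes \<alpha>: "\<alpha> \<notin> \<int>"
  shows "kummer_polynomial \<alpha> (\<alpha> / 2 + of_int j - of_nat n) ((\<alpha> + 1) / 2 - of_int j)"
proof -
  have half: "2 * (\<alpha> / 2 + of_int i) - \<alpha> \<in> \<int>" "2 * ((\<alpha> + 1) / 2 + of_int i) - \<alpha> \<in> \<int>" for i
  proof -
    have "2 * (\<alpha> / 2 + of_int i) - \<alpha> = of_int (2 * i)" "2 * ((\<alpha> + 1) / 2 + of_int i) - \<alpha> = of_int (2 * i + 1)"
      by (simp_all add: field_simps)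
    then show "2 * (\<alpha> / 2 + of_int i) - \<alpha> \<in> \<int>" "2 * ((\<alpha> + 1) / 2 + of_int i) - \<alpha> \<in> \<int>"
      by (metis Ints_of_int)+
  qed
  interpret base: hypergeo_pair \<alpha> "\<alpha> / 2" "(\<alpha> + 1) / 2"
    "kummer_fps \<alpha> 0 (\<alpha> / 2) ((\<alpha> + 1) / 2)" "kummer_fps \<alpha> \<alpha> (\<alpha> / 2) ((\<alpha> + 1) / 2)"
    using \<alpha> by unfold_locales (auto intro: kummer_fps_hypergeo_eq)
  have base: "kummer_polynomial \<alpha> (\<alpha> / 2) ((\<alpha> + 1) / 2)"
    unfolding polynomial_pair_def base.P_def[symmetric] base.W_def[symmetric]
      base.base_case[OF refl refl kummer_fps_nth_0 kummer_fps_nth_0 \<alpha>]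
    by (intro conjI polynomial_fps_intros)
  have down: "kummer_polynomial \<alpha> (\<alpha> / 2 - of_nat k) ((\<alpha> + 1) / 2 + of_nat k)" for k
  proof (induction k)
    case (Suc k)
    show ?case
      using kummer_polynomial_exchange[OF \<alpha> _ _ Suc] half(1)[of "- int k"] half(2)[of "int k"]
      by (simp add: algebra_simps)
  qed (use base in simp)
  \<comment> \<open>With the roles of \<open>a\<close> and \<open>b\<close> swapped, the same
    exchange moves \<open>(s, t)\<close> to \<open>(s - 1, t + 1)\<close>.\<close>
  have up: "kummer_polynomial \<alpha> ((\<alpha> + 1) / 2 - of_nat k) (\<alpha> / 2 + of_nat k)" for k
  proof (induction k)
    case (Suc k)
    show ?case
      using kummer_polynomial_exchange[OF \<alpha> _ _ Suc] half(2)[of "- int k"] half(1)[of "int k"]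
      by (simp add: algebra_simps)
  qed (use base kummer_polynomial_commute in simp)
  show ?thesis
  proof (induction n)
    case 0
    show ?case
      using down up[unfolded kummer_polynomial_commute[of \<alpha> "(\<alpha> + 1) / 2 - _"]]
      by (cases j rule: int_cases4) auto
  next
    case (Suc n)
    show ?case
      using kummer_polynomial_raise[OF \<alpha> _ Suc] half(1)[of "j - int n"]
      by (simp add: algebra_simps)
  qed
qed

section \<open>Specialization to \<open>s\<close> and \<open>t\<close>, evaluation in the unit disc,
  and selection of the degree\<close>

theorem theorem3p3:
  fixes s t :: real and \<alpha> :: complex
  assumes "2 * s \<in> \<int>" and "2 * t \<in> \<int>"
    and "s + t + 1 \<in> \<nat> - {0}"
    and "\<alpha> \<notin> \<int>"
  shows "\<exists>p :: complex poly. p \<noteq> 0 \<and>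
           (\<forall>x. norm x < 1 \<longrightarrow> hypergeo_prod s t \<alpha> x = poly p x) \<and>
           (s - t + 1 \<in> \<nat> - {0} \<longrightarrow> real (degree p) = 2 * s) \<and>
           (t - s \<in> \<nat> - {0} \<longrightarrow> real (degree p) = 2 * t - 1)"
proof -
  define a b where "a = \<alpha> / 2 - of_real s" and "b = (\<alpha> + 1) / 2 - of_real t"
  define u v where "u = kummer_fps \<alpha> 0 a b" and "v = kummer_fps \<alpha> \<alpha> a b"
  obtain n :: nat where n: "s + t = real n"
  proof -
    obtain m where m: "s + t + 1 = real m" "m \<noteq> 0"
      using assms(3) by (auto elim!: Nats_cases)
    then have "s + t = real (m - 1)" by (simp add: of_nat_diff)
    then show thesis by (rule that)
  qed
  obtain i where i: "2 * s = of_int i" using assms(1) by (auto elim: Ints_cases)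
  obtain k where k: "2 * t = of_int k" using assms(2) by (auto elim: Ints_cases)
  have pair: "polynomial_pair \<alpha> u v"
  proof (cases "even k")
    case True
    then obtain j where "k = 2 * j" by (rule evenE)
    then have t: "t = of_int j" using k by simp
    then have s: "s = real n - of_int j" using n by simp
    have "\<alpha> / 2 + of_int j - of_nat n = a" "(\<alpha> + 1) / 2 - of_int j = b"
      by (simp_all add: a_def b_def s t)
    then show ?thesis
      using kummer_polynomial_half_integers[OF assms(4), of j n]
      by (simp add: u_def v_def)
  next
    case False
    text \<open>The parameters \<open>(s, t)\<close> and \<open>(t - 1 / 2, s + 1 / 2)\<close> give the same \<open>{a, b}\<close>.\<close>
    then obtain l where "k = 2 * l + 1" by (rule oddE)
    then have t: "t = of_int l + 1 / 2" using k by simp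
    define j where "j = int n - l"
    have s: "s = of_int j - 1 / 2" using n t by (simp add: j_def)
    have "\<alpha> / 2 + of_int j - of_nat n = b" "(\<alpha> + 1) / 2 - of_int j = a"
      by (simp_all add: a_def b_def s t j_def field_simps)
    then show ?thesis
      using kummer_polynomial_half_integers[OF assms(4), of j n]
      by (simp add: u_def v_def kummer_fps_commute)
  qed
  interpret hypergeo_pair \<alpha> a b u v
    unfolding u_def v_def using assms(4) by unfold_locales (auto intro: kummer_fps_hypergeo_eq)
  obtain p where p: "P = fps_of_poly p" and W: "polynomial_fps W"
    using pair unfolding polynomial_pair_def P_def W_def by blast
  have P0: "fps_nth P 0 = 1" unfolding P_def by (simp add: u_def v_def kummer_fps_nth_0)
  then have "p \<noteq> 0" using p by auto
  have eval: "hypergeo_prod s t \<alpha> x = poly p x" if "norm x < 1" for x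
  proof -
    have not_Ints: "a - \<beta> \<notin> \<int>" "b - \<beta> \<notin> \<int>" if "\<beta> \<in> {0, \<alpha>}" for \<beta>
    proof -
      have "2 * a - \<alpha> = - of_real (2 * s)" "2 * b - \<alpha> = 1 - of_real (2 * t)"
        by (simp_all add: a_def b_def field_simps)
      then have "2 * a - \<alpha> \<in> \<int>" "2 * b - \<alpha> \<in> \<int>"
        unfolding i k by simp_all
      then show "a - \<beta> \<notin> \<int>" "b - \<beta> \<notin> \<int>"
        using shift_nonzero[OF assms(4) that] by blast+
    qed
    have radius: "fps_conv_radius (kummer_fps \<alpha> \<beta> a b) = 1" if "\<beta> \<in> {0, \<alpha>}" for \<beta>
      unfolding kummer_fps_def
      by (intro fps_conv_radius_gauss_fps not_Ints kummer_not_Ints assms(4) that)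
    have "hypergeo_F a' b' c' x = eval_fps (gauss_fps a' b' c') x" for a' b' c'
      by (simp add: hypergeo_F_def eval_fps_def gauss_fps_def)
    then have "hypergeo_prod s t \<alpha> x = eval_fps u x * eval_fps v x"
      by (simp add: hypergeo_prod_def u_def v_def kummer_fps_def a_def b_def field_simps)
    also have "\<dots> = eval_fps P x"
      unfolding P_def using that radius by (subst eval_fps_mult) (simp_all add: u_def v_def)
    finally show ?thesis by (simp add: p)
  qed
  let ?e = "real (degree p)"
  have "2 * (a + b) - 2 * \<alpha> - 1 = of_real (- 2 * (s + t))"
    by (simp add: a_def b_def field_simps)
  then have "2 * (a + b) - 2 * \<alpha> - 1 = - of_nat (2 * n)"
    by (simp add: n)
  moreover have "\<alpha> \<noteq> 0" using assms(4) by auto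
  ultimately have "2 * n \<le> 2 * degree p + 1"
    using degree_lower_bound[OF p W, of "2 * n"] P0 by simp
  \<comment> \<open>Integrality of both sides absorbs the extra 1.\<close>
  then have bound: "s + t \<le> ?e" using n by simp
  have "(of_nat (degree p) - \<alpha> + 2 * a) * (of_nat (degree p) - \<alpha> + 2 * b) * (of_nat (degree p) - \<alpha> + a + b)
      = of_real ((?e - 2 * s) * (?e + 1 - 2 * t) * (?e - s - t + 1 / 2))"
    by (simp add: a_def b_def field_simps)
  then have "(?e - 2 * s) * (?e + 1 - 2 * t) * (?e - s - t + 1 / 2) = 0"
    using indicial_at_infinity[OF p \<open>p \<noteq> 0\<close>] by (metis of_real_eq_0_iff)
  \<comment> \<open>The third root \<open>s + t - 1 / 2\<close> lies below the bound.\<close>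
  then have deg: "?e = 2 * s \<or> ?e = 2 * t - 1"
    using bound by auto
  have "?e = 2 * s" if st: "s - t + 1 \<in> \<nat> - {0}"
  proof -
    \<comment> \<open>For \<open>s \<ge> t\<close> the alternative \<open>2 * t - 1\<close> is
      smaller than \<open>s + t\<close>; for \<open>t \<ge> s + 1\<close>, below,
      \<open>2 * s\<close> is.\<close>
    have "s - t + 1 \<ge> 1" using st by (auto elim!: Nats_cases)
    then show ?thesis using deg bound by auto
  qed
  moreover have "?e = 2 * t - 1" if st: "t - s \<in> \<nat> - {0}"
  proof -
    have "t - s \<ge> 1" using st by (auto elim!: Nats_cases)
    then show ?thesis using deg bound by auto
  qed
  ultimately show ?thesis using \<open>p \<noteq> 0\<close> eval by blast
qed

end
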